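(* For every integer $d\ge 3$, there exist infinitely many triangulations $K$ of the $d$-simplex $\Delta^d$ such that the graph $G_K$ is not $(d+2)$-critical.
   Context: A triangulation of the $d$-simplex $\Delta^d$ (with vertices $v_1,\dots,v_{d+1}$) is a finite geometric simplicial complex $K$ whose union of simplices is $\Delta^d$; the vertices $v_1,\dots,v_{d+1}$ are vertices of $K$. The graph $G_K$ has vertex set consisting of: (V1) the vertices $u_1,\dots,u_n$ of $K$; (V2) a vertex $v_\rho$ for each $d$-simplex $\rho$ of $K$; (V3) a vertex $w_\tau$ for each $(d-1)$-dimensional face $\tau$ of $\Delta^d$. Its edges are: $u_iv_\rho$ whenever $u_i$ is a vertex of $\rho$; $u_iw_\tau$ whenever $u_i$ lies in the $(d-1)$-face $\tau$ of $\Delta^d$; and $w_\tau w_{\tau'}$ for every pair of distinct $(d-1)$-faces $\tau,\tau'$ of $\Delta^d$. A graph is $k$-chromatic if its chromatic number is $k$, and $k$-critical if it is $k$-chromatic and deleting any edge yields a $(k-1)$-colourable graph. *)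

theory Defs
  imports "HOL-Analysis.Analysis"
begin

subsection \<open>Triangulations of a simplex\<close>

definition complex_vertices :: "'a::euclidean_space set set \<Rightarrow> 'a set" where
  "complex_vertices K = {u. {u} \<in> K}"

text \<open>In HOL-Analysis, a \<^const>\<open>simplicial_complex\<close> is a finite collection of geometric simplices
  (as point sets) containing the empty simplex whenever it is nonempty.\<close>

definition triangulation_of :: "'a::euclidean_space set set \<Rightarrow> 'a set \<Rightarrow> bool" where
  "triangulation_of K T \<longleftrightarrow>
     simplicial_complex K \<and> \<Union>K = T \<and> (\<forall>v. v extreme_point_of T \<longrightarrow> v \<in> complex_vertices K)"

definition abstract_complex :: "'a::euclidean_space set set \<Rightarrow> 'a set set" where
  "abstract_complex K = (\<lambda>S. {x. x extreme_point_of S}) ` K"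

definition simplicially_isomorphic ::
    "'a::euclidean_space set set \<Rightarrow> 'a set set \<Rightarrow> bool" where
  "simplicially_isomorphic K L \<longleftrightarrow>
     (\<exists>f. bij_betw f (complex_vertices K) (complex_vertices L) \<and>
          (\<lambda>A. f ` A) ` abstract_complex K = abstract_complex L)"

subsection \<open>Simple graphs and criticality\<close>

text \<open>A graph is a pair of a vertex set and a set of edges, each edge being a two-element set of
  vertices.\<close>

type_synonym 'v ugraph = "'v set \<times> 'v set set"

definition colourable :: "nat \<Rightarrow> 'v ugraph \<Rightarrow> bool" where
  "colourable k G \<longleftrightarrow>
     (\<exists>c :: 'v \<Rightarrow> nat. (\<forall>v \<in> fst G. c v < k) \<and> (\<forall>u v. {u, v} \<in> snd G \<longrightarrow> c u \<noteq> c v))"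

text \<open>Meaningful for finite graphs, for which some \<open>k\<close> exists.\<close>

definition chromatic_number :: "'v ugraph \<Rightarrow> nat" where
  "chromatic_number G = (LEAST k. colourable k G)"

definition critical :: "nat \<Rightarrow> 'v ugraph \<Rightarrow> bool" where
  "critical k G \<longleftrightarrow>
     chromatic_number G = k \<and> (\<forall>e \<in> snd G. colourable (k - 1) (fst G, snd G - {e}))"

subsection \<open>The graph of a triangulation\<close>

text \<open>The constructors keep the three kinds of vertices disjoint.\<close>

datatype 'a gvertex = Pt 'a | Cell "'a set" | Facet "'a set"

definition cells :: "nat \<Rightarrow> 'a::euclidean_space set set \<Rightarrow> 'a set set" where
  "cells d K = {\<rho> \<in> K. int d simplex \<rho>}"

text \<open>\<open>T\<close> is the \<open>d\<close>-simplex triangulated by \<open>K\<close>; its faces of dimension \<open>d - 1\<close> are its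
  facets.\<close>

definition triangulation_graph ::
    "nat \<Rightarrow> 'a::euclidean_space set \<Rightarrow> 'a set set \<Rightarrow> 'a gvertex ugraph" where
  "triangulation_graph d T K =
     (Pt ` complex_vertices K \<union> Cell ` cells d K \<union> Facet ` {\<tau>. \<tau> facet_of T},
      {{Pt u, Cell \<rho>} | u \<rho>. u \<in> complex_vertices K \<and> \<rho> \<in> cells d K \<and> u extreme_point_of \<rho>} \<union>
      {{Pt u, Facet \<tau>} | u \<tau>. u \<in> complex_vertices K \<and> \<tau> facet_of T \<and> u \<in> \<tau>} \<union>
      {{Facet \<tau>, Facet \<tau>'} | \<tau> \<tau>'. \<tau> facet_of T \<and> \<tau>' facet_of T \<and> \<tau> \<noteq> \<tau>'})"

end

theory Submission
  imports Defs
begin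

text \<open>Let \<open>R\<close> be a cell of a triangulation such that every Sperner labelling has a rainbow cell other
  than \<open>R\<close>. In a colouring of the graph with \<open>d + 1\<close> colours the facets receive all the colours, so
  the colours of the points form a Sperner labelling, and the vertex of a rainbow cell cannot be
  coloured; deleting an edge between \<open>R\<close> and one of its corners does not help, hence the graph is
  not critical. The property persists when a cell other than \<open>R\<close> is subdivided at an interior point,
  because one of the new cells of a subdivided rainbow cell is again rainbow. This gives infinitely
  many triangulations from one.

  The first one is a triangulation of the tetrahedron with four interior points, any two of its
  eight vertices being adjacent, into 19 cells; \<open>R\<close> is the cell spanned by the four interior
  points. In higher dimension the tetrahedron is joined with the remaining corners of the simplex.\<close>

subsection \<open>Affine independence and convex hulls\<close>

text \<open>With one point translated to the origin the others become linearly independent, so the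
  prescribed differences extend to a linear map.\<close>

lemma affine_functional_exists:
  fixes S :: "'a::euclidean_space set"
  assumes "\<not> affine_dependent S"
  obtains a b where "\<And>x. x \<in> S \<Longrightarrow> a \<bullet> x + b = c x"
proof (cases "S = {}")
  case False
  then obtain s where s: "s \<in> S" by auto
  let ?B = "(\<lambda>x. - s + x) ` (S - {s})"
  have "independent ?B"
    using assms s affine_dependent_iff_dependent2 by blast
  then obtain g :: "'a \<Rightarrow> real" where g: "linear g" "\<forall>y\<in>?B. g y = c (s + y) - c s"
    using linear_independent_extend[of ?B "\<lambda>y. c (s + y) - c s"] by blast
  \<comment> \<open>The vector representing \<open>g\<close>: the number \<open>g y\<close> is the
    inner product of \<open>g y\<close> with 1, hence that of \<open>y\<close> with
    \<open>adjoint g 1\<close>.\<close>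
  define a where "a = adjoint g 1"
  have ga: "g y = a \<bullet> y" for y
    using adjoint_works[OF g(1), of y 1] by (simp add: a_def inner_commute)
  have "a \<bullet> x + (c s - a \<bullet> s) = c x" if "x \<in> S" for x
  proof (cases "x = s")
    case False
    then have "g (- s + x) = c (s + (- s + x)) - c s"
      using g(2) that by blast
    then show ?thesis by (simp add: ga inner_diff_right algebra_simps)
  qed simp
  then show ?thesis by (rule that)
qed (use that in auto)

lemma inner_affine_combination:
  fixes a :: "'a::euclidean_space"
  assumes "sum u S = 1"
  shows "a \<bullet> (\<Sum>x\<in>S. u x *\<^sub>R f x) + b = (\<Sum>x\<in>S. u x * (a \<bullet> f x + b))"
  using assms by (simp add: inner_sum_right distrib_left sum.distrib flip: sum_distrib_right)

lemma affine_functional_nonneg_convex_hull: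
  fixes a :: "'a::euclidean_space"
  assumes "\<And>x. x \<in> S \<Longrightarrow> 0 \<le> a \<bullet> x + b" and "z \<in> convex hull S"
  shows "0 \<le> a \<bullet> z + b"
proof -
  have "convex hull S \<subseteq> {x. a \<bullet> x \<ge> - b}"
    using assms(1) by (intro hull_minimal convex_halfspace_ge) force
  then show ?thesis using assms(2) by auto
qed

text \<open>A vanishing convex combination of nonnegative values gives no weight to the positive
  ones.\<close>

lemma affine_functional_zero_convex_hull:
  fixes a :: "'a::euclidean_space"
  assumes "finite S" and "\<And>x. x \<in> S \<Longrightarrow> 0 \<le> a \<bullet> x + b"
    and "z \<in> convex hull S" and "a \<bullet> z + b = 0"
  shows "z \<in> convex hull {x \<in> S. a \<bullet> x + b = 0}"
proof -
  let ?Z = "{x \<in> S. a \<bullet> x + b = 0}"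
  obtain u where u: "\<And>x. x \<in> S \<Longrightarrow> 0 \<le> u x" "sum u S = 1" "(\<Sum>x\<in>S. u x *\<^sub>R x) = z"
    using assms(1,3) by (auto simp: convex_hull_finite)
  have "(\<Sum>x\<in>S. u x * (a \<bullet> x + b)) = 0"
    using inner_affine_combination[OF u(2), of a "\<lambda>x. x" b] u(3) assms(4) by simp
  then have "\<forall>x\<in>S. u x * (a \<bullet> x + b) = 0"
    using assms(1,2) u(1) by (subst (asm) sum_nonneg_eq_0_iff) auto
  then have 0: "\<And>x. x \<in> S - ?Z \<Longrightarrow> u x = 0" by auto
  have "sum u ?Z = 1"
    using u(2) 0 assms(1) by (subst sum.mono_neutral_left[of S ?Z u]) auto
  moreover have "(\<Sum>x\<in>?Z. u x *\<^sub>R x) = z"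
    unfolding u(3)[symmetric] using 0 assms(1) by (intro sum.mono_neutral_left) auto
  ultimately show ?thesis
    using u(1) assms(1) by (auto simp: convex_hull_finite intro!: exI[of _ u])
qed

text \<open>A common point must lie on the hyperplane, hence in the hull of those points of
  \<open>S\<close> that lie on it, and these belong to \<open>S'\<close>. This criterion serves both
  the subdivision and the concrete example.\<close>

lemma convex_hull_Int_separated:
  fixes a :: "'a::euclidean_space"
  assumes "finite S"
    and "\<And>x. x \<in> S \<Longrightarrow> 0 \<le> a \<bullet> x + b" and "\<And>x. x \<in> S' \<Longrightarrow> a \<bullet> x + b \<le> 0"
    and "\<And>x. x \<in> S \<Longrightarrow> a \<bullet> x + b = 0 \<Longrightarrow> x \<in> S'"
  shows "convex hull S \<inter> convex hull S' \<subseteq> convex hull (S \<inter> S')"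
proof
  fix z assume z: "z \<in> convex hull S \<inter> convex hull S'"
  have "convex hull S' \<subseteq> {x. a \<bullet> x \<le> - b}"
    using assms(3) by (intro hull_minimal convex_halfspace_le) force
  moreover have "0 \<le> a \<bullet> z + b"
    using affine_functional_nonneg_convex_hull[OF assms(2)] z by blast
  ultimately have "a \<bullet> z + b = 0" using z by fastforce
  then have "z \<in> convex hull {x \<in> S. a \<bullet> x + b = 0}"
    using affine_functional_zero_convex_hull[OF assms(1,2)] z by blast
  then show "z \<in> convex hull (S \<inter> S')"
    using assms(4) hull_mono[of "{x \<in> S. a \<bullet> x + b = 0}" "S \<inter> S'"] by blast
qed

text \<open>From a convex representation \<open>u\<close> of \<open>z\<close>, subtract the largest
  multiple \<open>t\<close> of \<open>l\<close> that keeps all coefficients nonnegative, and give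
  the weight \<open>t\<close> to \<open>q\<close>; the coefficient of some \<open>s\<close> with
  \<open>0 < l s\<close> drops to zero. Negative entries of \<open>l\<close> are allowed, so
  \<open>q\<close> may lie outside the hull of \<open>S\<close>.\<close>

lemma convex_hull_exchange_cover:
  fixes S :: "'a::euclidean_space set"
  assumes "finite S" and l: "sum l S = 1" "(\<Sum>x\<in>S. l x *\<^sub>R x) = q" and "q \<notin> S"
  shows "convex hull S \<subseteq> (\<Union>s\<in>{s\<in>S. 0 < l s}. convex hull (insert q (S - {s})))"
proof
  fix z assume "z \<in> convex hull S"
  then obtain u where u: "\<And>x. x \<in> S \<Longrightarrow> 0 \<le> u x" "sum u S = 1" "(\<Sum>x\<in>S. u x *\<^sub>R x) = z"
    using assms(1) by (auto simp: convex_hull_finite)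
  let ?P = "{s\<in>S. 0 < l s}"
  have "?P \<noteq> {}"
  proof
    assume "?P = {}"
    then have "sum l S \<le> 0" by (intro sum_nonpos) fastforce
    then show False using l(1) by simp
  qed
  moreover have "finite ?P" using assms(1) by auto
  ultimately obtain s where s: "s \<in> ?P" "\<And>x. x \<in> ?P \<Longrightarrow> u s / l s \<le> u x / l x"
    using ex_is_arg_min_if_finite[of ?P "\<lambda>x. u x / l x"] by (auto simp: is_arg_min_linorder)
  define t where "t = u s / l s"
  have t0: "0 \<le> t" using s u(1) by (auto simp: t_def)
  define w where "w x = (if x = q then t else u x - t * l x)" for x
  have ws: "u s - t * l s = 0" using s by (auto simp: t_def)
  have wpos: "0 \<le> u x - t * l x" if "x \<in> S" for x
  proof (cases "0 < l x")
    case True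
    then show ?thesis using s(2)[of x] that by (auto simp: t_def field_simps)
  next
    case False
    then have "t * l x \<le> 0" using t0 by (simp add: mult_nonneg_nonpos)
    then show ?thesis using u(1)[OF that] by linarith
  qed
  have wS: "w x = u x - t * l x" if "x \<in> S" for x
    using that assms(4) by (auto simp: w_def)
  have sS: "s \<in> S" using s by auto
  have "sum w (S - {s}) = sum w S"
    using ws wS[OF sS] sS assms(1) by (simp add: sum.remove[of S s w])
  also have "\<dots> = 1 - t"
    using u(2) l(1) wS by (simp add: sum_subtractf flip: sum_distrib_left)
  finally have 1: "sum w (insert q (S - {s})) = 1"
    using assms(1,4) by (simp add: w_def)
  have "(\<Sum>x\<in>S - {s}. w x *\<^sub>R x) = (\<Sum>x\<in>S. w x *\<^sub>R x)"
    using ws wS[OF sS] sS assms(1) by (simp add: sum.remove[of S s "\<lambda>x. w x *\<^sub>R x"])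
  also have "\<dots> = (\<Sum>x\<in>S. u x *\<^sub>R x - t *\<^sub>R (l x *\<^sub>R x))"
    using wS by (intro sum.cong) (auto simp: scaleR_diff_left)
  also have "\<dots> = z - t *\<^sub>R q"
    by (simp add: sum_subtractf u(3) scaleR_sum_right flip: l(2))
  finally have 2: "(\<Sum>x\<in>insert q (S - {s}). w x *\<^sub>R x) = z"
    using assms(1,4) by (simp add: w_def)
  have "z \<in> convex hull (insert q (S - {s}))"
    using 1 2 assms(1) wpos wS t0
    by (subst convex_hull_finite) (auto intro!: exI[of _ w] simp: w_def)
  then show "z \<in> (\<Union>s\<in>?P. convex hull (insert q (S - {s})))" using s by blast
qed

text \<open>The functional that is 1 at \<open>s\<close> and 0 on the rest of \<open>S\<close> takes
  the value \<open>l s\<close> at \<open>q\<close>, so \<open>q\<close> lies off the affine hull of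
  \<open>S - {s}\<close>.\<close>

lemma affine_independent_exchange:
  fixes S :: "'a::euclidean_space set"
  assumes S: "\<not> affine_dependent S" and l: "sum l S = 1" "(\<Sum>x\<in>S. l x *\<^sub>R x) = q"
    and s: "s \<in> S" "l s \<noteq> 0"
  shows "\<not> affine_dependent (insert q (S - {s}))"
proof (rule affine_independent_insert)
  show "\<not> affine_dependent (S - {s})"
    using S affine_dependent_subset by blast
  show "q \<notin> affine hull (S - {s})"
  proof
    assume q: "q \<in> affine hull (S - {s})"
    obtain a b where ab: "\<And>x. x \<in> S \<Longrightarrow> a \<bullet> x + b = (if x = s then 1 else 0)"
      using affine_functional_exists[OF S, of "\<lambda>x. if x = s then 1 else 0"] by blast
    have "affine hull (S - {s}) \<subseteq> {x. a \<bullet> x = - b}"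
      using ab by (intro hull_minimal affine_hyperplane) force
    then have "a \<bullet> q + b = 0" using q by auto
    moreover have "a \<bullet> q + b = (\<Sum>x\<in>S. l x * (if x = s then 1 else 0))"
      using inner_affine_combination[OF l(1), of a "\<lambda>x. x" b] l(2) ab by simp
    moreover have "\<dots> = l s"
      using s aff_independent_finite[OF S] by (simp add: if_distrib cong: if_cong)
    ultimately show False using s by simp
  qed
qed

subsection \<open>Simplicial complexes given by their cells\<close>

text \<open>A triangulation is represented by the corner sets of its top-dimensional cells. The
  intersection condition is imposed on these cells only; \<open>convex_hull_Int_faces\<close>
  transfers it to their faces.\<close>

definition triangulating :: "'a::euclidean_space set \<Rightarrow> 'a set set \<Rightarrow> bool" where
  "triangulating V \<S> \<longleftrightarrow> finite \<S> \<and>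
     (\<forall>S\<in>\<S>. \<not> affine_dependent S \<and> card S = card V) \<and>
     (\<forall>S\<in>\<S>. \<forall>S'\<in>\<S>. convex hull S \<inter> convex hull S' \<subseteq> convex hull (S \<inter> S')) \<and>
     (\<Union>S\<in>\<S>. convex hull S) = convex hull V"

text \<open>The choice \<open>A = {}\<close> supplies the empty simplex, which closure under faces
  demands.\<close>

definition face_complex :: "'a::euclidean_space set set \<Rightarrow> 'a set set" where
  "face_complex \<S> = {convex hull A |A S. S \<in> \<S> \<and> A \<subseteq> S}"

lemma convex_hull_inj_affine_independent:
  fixes A B :: "'a::euclidean_space set"
  assumes "\<not> affine_dependent A" "\<not> affine_dependent B" "convex hull A = convex hull B"
  shows "A = B"
  using assms by (metis extreme_point_of_convex_hull_affine_independent subsetI subset_antisym)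

context
  fixes V :: "'a::euclidean_space set" and \<S>
  assumes tri: "triangulating V \<S>"
begin

lemma independent_subset_cell: "S \<in> \<S> \<Longrightarrow> A \<subseteq> S \<Longrightarrow> \<not> affine_dependent A"
  using tri affine_dependent_subset unfolding triangulating_def by blast

lemma finite_subset_cell: "S \<in> \<S> \<Longrightarrow> A \<subseteq> S \<Longrightarrow> finite A"
  using independent_subset_cell aff_independent_finite by blast

text \<open>A common point lies in the hull of \<open>S \<inter> S'\<close>; it is then cut down to
  \<open>A\<close> inside \<open>S\<close> and to \<open>B\<close> inside \<open>S'\<close>, since
  within one cell affine independence makes hulls commute with intersections.\<close>

lemma convex_hull_Int_faces:
  assumes "S \<in> \<S>" "A \<subseteq> S" "S' \<in> \<S>" "B \<subseteq> S'"
  shows "convex hull A \<inter> convex hull B = convex hull (A \<inter> B)"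
proof
  show "convex hull (A \<inter> B) \<subseteq> convex hull A \<inter> convex hull B"
    by (simp add: hull_mono)
  show "convex hull A \<inter> convex hull B \<subseteq> convex hull (A \<inter> B)"
  proof
    fix z assume z: "z \<in> convex hull A \<inter> convex hull B"
    have "convex hull A \<subseteq> convex hull S" "convex hull B \<subseteq> convex hull S'"
      using assms by (simp_all add: hull_mono)
    then have "z \<in> convex hull S \<inter> convex hull S'" using z by blast
    then have "z \<in> convex hull (S \<inter> S')"
      using tri assms(1,3) unfolding triangulating_def by blast
    moreover have "\<not> affine_dependent (A \<union> (S \<inter> S'))"
      using assms(2) by (intro independent_subset_cell[OF assms(1)]) auto
    ultimately have "z \<in> convex hull (A \<inter> (S \<inter> S'))"
      using z by (simp add: convex_hull_Int)
    moreover have "A \<inter> (S \<inter> S') \<subseteq> A \<inter> S'" by blast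
    ultimately have "z \<in> convex hull (A \<inter> S')" using hull_mono by blast
    moreover have "\<not> affine_dependent ((A \<inter> S') \<union> B)"
      using assms(4) by (intro independent_subset_cell[OF assms(3)]) auto
    ultimately have "z \<in> convex hull (A \<inter> S' \<inter> B)"
      using z by (simp add: convex_hull_Int)
    moreover have "A \<inter> S' \<inter> B \<subseteq> A \<inter> B" by blast
    ultimately show "z \<in> convex hull (A \<inter> B)" using hull_mono by blast
  qed
qed

lemma simplicial_complex_face_complex: "simplicial_complex (face_complex \<S>)"
  unfolding simplicial_complex_def
proof (intro conjI ballI allI impI)
  have "finite (\<Union>S\<in>\<S>. (\<lambda>A. convex hull A) ` Pow S)"
    using tri finite_subset_cell by (auto simp: triangulating_def)
  moreover have "face_complex \<S> = (\<Union>S\<in>\<S>. (\<lambda>A. convex hull A) ` Pow S)"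
    unfolding face_complex_def by blast
  ultimately show "finite (face_complex \<S>)" by simp
next
  fix F assume "F \<in> face_complex \<S>"
  then obtain A S where "F = convex hull A" "S \<in> \<S>" "A \<subseteq> S"
    by (auto simp: face_complex_def)
  then show "\<exists>n. n simplex F"
    using independent_subset_cell unfolding simplex_def
    \<comment> \<open>The dimension is an integer: it is -1 for the empty face.\<close>
    by (intro exI[of _ "int (card A) - 1"] exI[of _ A]) auto
next
  fix F G assume FG: "G \<in> face_complex \<S> \<and> F face_of G"
  then obtain A S where A: "G = convex hull A" "S \<in> \<S>" "A \<subseteq> S"
    by (auto simp: face_complex_def)
  then obtain B where "B \<subseteq> A" "F = convex hull B"
    using FG A(1) face_of_convex_hull_affine_independent[OF independent_subset_cell[OF A(2,3)]]
    by auto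
  then show "F \<in> face_complex \<S>"
    using A(2,3) unfolding face_complex_def by auto
next
  fix F G assume "F \<in> face_complex \<S> \<and> G \<in> face_complex \<S>"
  then obtain A S B S' where A: "F = convex hull A" "S \<in> \<S>" "A \<subseteq> S"
    and B: "G = convex hull B" "S' \<in> \<S>" "B \<subseteq> S'"
    by (auto simp: face_complex_def)
  have "F \<inter> G = convex hull (A \<inter> B)"
    using convex_hull_Int_faces[OF A(2,3) B(2,3)] A(1) B(1) by simp
  then show "F \<inter> G face_of F"
    using A(1) face_of_convex_hull_affine_independent[OF independent_subset_cell[OF A(2,3)]] by auto
qed

lemma complex_vertices_face_complex: "complex_vertices (face_complex \<S>) = \<Union>\<S>"
proof (intro set_eqI iffI)
  fix u assume "u \<in> complex_vertices (face_complex \<S>)"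
  then obtain A S where A: "{u} = convex hull A" "S \<in> \<S>" "A \<subseteq> S"
    by (auto simp: complex_vertices_def face_complex_def)
  have "{u} = A"
    by (rule convex_hull_inj_affine_independent)
      (simp_all add: A(1)[symmetric] independent_subset_cell[OF A(2,3)])
  then show "u \<in> \<Union>\<S>" using A by auto
next
  fix u assume "u \<in> \<Union>\<S>"
  then have "convex hull {u} \<in> face_complex \<S>"
    unfolding face_complex_def by blast
  then show "u \<in> complex_vertices (face_complex \<S>)"
    by (simp add: complex_vertices_def)
qed

lemma Union_face_complex: "\<Union>(face_complex \<S>) = convex hull V"
proof -
  have "\<Union>(face_complex \<S>) = (\<Union>S\<in>\<S>. convex hull S)"
    unfolding face_complex_def using hull_mono[of _ _ convex] by blast
  then show ?thesis using tri by (simp add: triangulating_def)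
qed

text \<open>An extreme point of the whole simplex stays extreme in any cell containing it, hence is
  a corner of that cell.\<close>

lemma vertices_subset_Union:
  assumes "\<not> affine_dependent V"
  shows "V \<subseteq> \<Union>\<S>"
proof
  fix v assume v: "v \<in> V"
  then have ext: "v extreme_point_of (convex hull V)"
    using assms extreme_point_of_convex_hull_affine_independent by blast
  have "v \<in> (\<Union>S\<in>\<S>. convex hull S)"
    using tri v hull_inc[of v V convex] by (simp add: triangulating_def)
  then obtain S where S: "S \<in> \<S>" "v \<in> convex hull S" by blast
  moreover have "convex hull S \<subseteq> convex hull V"
    using S tri unfolding triangulating_def by blast
  ultimately have "v extreme_point_of (convex hull S)"
    using ext by (auto simp: extreme_point_of_def)
  then show "v \<in> \<Union>\<S>"
    using S extreme_point_of_convex_hull by blast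
qed

lemma triangulation_of_face_complex:
  assumes "\<not> affine_dependent V"
  shows "triangulation_of (face_complex \<S>) (convex hull V)"
  using vertices_subset_Union[OF assms]
  by (auto simp: triangulation_of_def simplicial_complex_face_complex Union_face_complex
      complex_vertices_face_complex extreme_point_of_convex_hull_affine_independent[OF assms])

lemma cell_in_cells:
  assumes "S \<in> \<S>" "card V = Suc d"
  shows "convex hull S \<in> cells d (face_complex \<S>)"
proof -
  have "int d simplex (convex hull S)"
    unfolding simplex_def using assms tri
    by (intro exI[of _ S]) (auto simp: triangulating_def)
  then show ?thesis
    using assms(1) by (auto simp: cells_def face_complex_def)
qed

end

subsection \<open>Redundant cells\<close>

text \<open>For a point of the simplex, avoiding the facet opposite \<open>L u\<close> means that
  the barycentric coordinate at \<open>L u\<close> is positive: the usual Sperner condition.\<close>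

definition sperner_labelling :: "'a::euclidean_space set \<Rightarrow> 'a set \<Rightarrow> ('a \<Rightarrow> 'a) \<Rightarrow> bool" where
  "sperner_labelling V U L \<longleftrightarrow> (\<forall>u\<in>U. L u \<in> V \<and> u \<notin> convex hull (V - {L u}))"

definition redundant :: "'a::euclidean_space set \<Rightarrow> 'a set set \<Rightarrow> 'a set \<Rightarrow> bool" where
  "redundant V \<S> R \<longleftrightarrow> R \<in> \<S> \<and>
     (\<forall>L. sperner_labelling V (\<Union>\<S>) L \<longrightarrow> (\<exists>S\<in>\<S>. S \<noteq> R \<and> L ` S = V))"

lemma
  shows triangulation_graph_Pt_Cell: "\<lbrakk>u \<in> complex_vertices K; \<rho> \<in> cells d K; u extreme_point_of \<rho>\<rbrakk>
      \<Longrightarrow> {Pt u, Cell \<rho>} \<in> snd (triangulation_graph d T K)" (is "PROP ?A")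
    and triangulation_graph_Pt_Facet: "\<lbrakk>u \<in> complex_vertices K; \<tau> facet_of T; u \<in> \<tau>\<rbrakk>
      \<Longrightarrow> {Pt u, Facet \<tau>} \<in> snd (triangulation_graph d T K)" (is "PROP ?B")
    and triangulation_graph_Facet_Facet: "\<lbrakk>\<tau> facet_of T; \<tau>' facet_of T; \<tau> \<noteq> \<tau>'\<rbrakk>
      \<Longrightarrow> {Facet \<tau>, Facet \<tau>'} \<in> snd (triangulation_graph d T K)" (is "PROP ?C")
proof -
  show "PROP ?A"
    unfolding triangulation_graph_def snd_conv
    by (rule UnI1, rule UnI1, rule CollectI, intro exI conjI, rule refl)
  show "PROP ?B"
    unfolding triangulation_graph_def snd_conv
    by (rule UnI1, rule UnI2, rule CollectI, intro exI conjI, rule refl)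
  show "PROP ?C"
    unfolding triangulation_graph_def snd_conv
    by (rule UnI2, rule CollectI, intro exI conjI, rule refl)
qed

section \<open>Noncriticality from a redundant cell\<close>

lemma not_critical_if_redundant:
  fixes V :: "'a::euclidean_space set"
  assumes tri: "triangulating V \<S>" and red: "redundant V \<S> R"
    and V: "\<not> affine_dependent V" "card V = Suc d" and d: "1 \<le> d"
  shows "\<not> critical (d + 2) (triangulation_graph d (convex hull V) (face_complex \<S>))"
proof
  let ?K = "face_complex \<S>" and ?T = "convex hull V"
  define G where "G = triangulation_graph d ?T ?K"
  assume "critical (d + 2) (triangulation_graph d ?T ?K)"
  then have crit: "\<And>e. e \<in> snd G \<Longrightarrow> colourable (d + 1) (fst G, snd G - {e})"
    by (simp add: critical_def G_def)
  have R: "R \<in> \<S>" using red by (simp add: redundant_def)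
  have verts: "complex_vertices ?K = \<Union>\<S>"
    by (rule complex_vertices_face_complex[OF tri])
  have indep: "\<not> affine_dependent S" "card S = card V" if "S \<in> \<S>" for S
    using tri that by (auto simp: triangulating_def)
  have "R \<noteq> {}" using indep(2)[OF R] V(2) by auto
  then obtain r where r: "r \<in> R" by blast
  have cell_edge: "{Pt u, Cell (convex hull S)} \<in> snd G" if "u \<in> S" "S \<in> \<S>" for u S
    unfolding G_def using that cell_in_cells[OF tri that(2) V(2)]
    by (intro triangulation_graph_Pt_Cell)
      (auto simp: verts extreme_point_of_convex_hull_affine_independent[OF indep(1)[OF that(2)]])
  \<comment> \<open>The deleted edge ends at the vertex of \<open>R\<close>, so every other cell
    keeps all its edges.\<close>
  define e where "e = {Pt r, Cell (convex hull R)}"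
  define fc where "fc v = convex hull (V - {v})" for v
  have facet: "fc v facet_of ?T" if "v \<in> V" for v
    using that V d facet_of_convex_hull_affine_independent_alt[OF V(1)] by (auto simp: fc_def)
  have fc_inj: "v = v'" if "v \<in> V" "v' \<in> V" "fc v = fc v'" for v v'
  proof -
    have "V - {v} = V - {v'}"
      using that V(1) affine_independent_subset[OF V(1)]
      by (intro convex_hull_inj_affine_independent[of "V - {v}" "V - {v'}"]) (auto simp: fc_def)
    then show ?thesis using that by auto
  qed
  obtain c where c: "\<And>v. v \<in> fst G \<Longrightarrow> c v < d + 1"
    "\<And>u v. {u, v} \<in> snd G - {e} \<Longrightarrow> c u \<noteq> c v"
    using crit[of e] cell_edge[OF r R] unfolding e_def[symmetric] colourable_def by auto
  \<comment> \<open>The \<open>d + 1\<close> facets remain pairwise adjacent, as \<open>e\<close>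
    has no facet among its ends; so they use each of the \<open>d + 1\<close> colours exactly
    once.\<close>
  have "inj_on (\<lambda>v. c (Facet (fc v))) V"
  proof (rule inj_onI, rule ccontr)
    fix v v' assume v: "v \<in> V" "v' \<in> V" "c (Facet (fc v)) = c (Facet (fc v'))" "v \<noteq> v'"
    then have "{Facet (fc v), Facet (fc v')} \<in> snd G"
      unfolding G_def using facet fc_inj by (intro triangulation_graph_Facet_Facet) auto
    moreover have "{Facet (fc v), Facet (fc v')} \<noteq> e"
      by (auto simp: e_def doubleton_eq_iff)
    ultimately show False using c(2) v(3) by blast
  qed
  moreover have "(\<lambda>v. c (Facet (fc v))) ` V \<subseteq> {..<d + 1}"
    using c(1) facet by (force simp: G_def triangulation_graph_def)
  ultimately have surj: "(\<lambda>v. c (Facet (fc v))) ` V = {..<d + 1}"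
    using V(2) by (intro card_subset_eq) (auto simp: card_image)
  have "\<forall>u\<in>\<Union>\<S>. \<exists>v\<in>V. c (Pt u) = c (Facet (fc v))"
  proof
    fix u assume "u \<in> \<Union>\<S>"
    then have "c (Pt u) < d + 1"
      using c(1) verts by (auto simp: G_def triangulation_graph_def)
    then have "c (Pt u) \<in> (\<lambda>v. c (Facet (fc v))) ` V"
      unfolding surj by simp
    then show "\<exists>v\<in>V. c (Pt u) = c (Facet (fc v))" by blast
  qed
  \<comment> \<open>The label \<open>l u\<close> is the corner opposite the facet coloured like
    \<open>u\<close>. A point on that facet would be adjacent to it, which gives the Sperner
    condition.\<close>
  then have "\<exists>l. \<forall>u\<in>\<Union>\<S>. l u \<in> V \<and> c (Pt u) = c (Facet (fc (l u)))"
    by (intro bchoice) blast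
  then obtain l where l: "\<And>u. u \<in> \<Union>\<S> \<Longrightarrow> l u \<in> V"
    "\<And>u. u \<in> \<Union>\<S> \<Longrightarrow> c (Pt u) = c (Facet (fc (l u)))"
    by blast
  have "sperner_labelling V (\<Union>\<S>) l"
    unfolding sperner_labelling_def
  proof (intro ballI conjI notI)
    fix u assume u: "u \<in> \<Union>\<S>"
    then show "l u \<in> V" by (rule l)
    assume "u \<in> convex hull (V - {l u})"
    then have "{Pt u, Facet (fc (l u))} \<in> snd G"
      unfolding G_def using u l(1)[OF u] facet
      by (intro triangulation_graph_Pt_Facet) (auto simp: verts fc_def)
    moreover have "{Pt u, Facet (fc (l u))} \<noteq> e"
      by (auto simp: e_def doubleton_eq_iff)
    ultimately show False using c(2) l(2)[OF u] by blast
  qed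
  then obtain S where S: "S \<in> \<S>" "S \<noteq> R" "l ` S = V"
    using red unfolding redundant_def by blast
  \<comment> \<open>The vertex of the rainbow cell has the colour of some facet, which is also the
    colour of a corner of this cell.\<close>
  have "c (Cell (convex hull S)) < d + 1"
    using cell_in_cells[OF tri S(1) V(2)] by (intro c(1)) (simp add: G_def triangulation_graph_def)
  then have "c (Cell (convex hull S)) \<in> (\<lambda>v. c (Facet (fc v))) ` V"
    unfolding surj by simp
  then obtain v where v: "v \<in> V" "c (Cell (convex hull S)) = c (Facet (fc v))"
    by blast
  then obtain s where s: "s \<in> S" "v = l s" using S(3) by auto
  have "convex hull S \<noteq> convex hull R"
    using convex_hull_inj_affine_independent[OF indep(1)[OF S(1)] indep(1)[OF R]] S(2) by blast
  then have "{Pt s, Cell (convex hull S)} \<noteq> e"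
    by (auto simp: e_def doubleton_eq_iff)
  then have "c (Pt s) \<noteq> c (Cell (convex hull S))"
    using c(2) cell_edge[OF s(1) S(1)] by blast
  moreover have "c (Pt s) = c (Facet (fc (l s)))"
    using l(2) s(1) S(1) by blast
  ultimately show False using v(2) s(2) by simp
qed

section \<open>Adding a vertex by stellar subdivision\<close>

text \<open>The cell \<open>S\<close> is replaced by the cones from its barycentre over its facets.
  The existence of a cell other than \<open>R\<close> is carried along so that the construction can
  be iterated.\<close>

lemma stellar_subdivision:
  fixes V :: "'a::euclidean_space set"
  assumes tri: "triangulating V \<S>" and red: "redundant V \<S> R"
    and S: "S \<in> \<S>" "S \<noteq> R" and V: "2 \<le> card V"
  obtains \<S>' where "triangulating V \<S>'" "redundant V \<S>' R" "\<exists>S\<in>\<S>'. S \<noteq> R"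
    "card (\<Union>\<S>') = Suc (card (\<Union>\<S>))"
proof -
  have indep: "\<not> affine_dependent S" "card S = card V" if "S \<in> \<S>" for S
    using tri that by (auto simp: triangulating_def)
  have fin: "finite S" if "S \<in> \<S>" for S
    using aff_independent_finite indep that by blast
  have Sfin: "finite S" by (rule fin[OF S(1)])
  have cardS: "2 \<le> card S" using indep(2) S V by simp
  define n where "n = real (card S)"
  have n: "n > 0" using cardS by (simp add: n_def)
  \<comment> \<open>The barycentre has equal weights; this makes the functional that separates two
    new cells vanish at \<open>q\<close>.\<close>
  define q where "q = (\<Sum>x\<in>S. (1 / n) *\<^sub>R x)"
  have l1: "sum (\<lambda>x. 1 / n) S = 1" using n by (simp add: n_def)
  have q_val: "a \<bullet> q + b = (\<Sum>x\<in>S. (a \<bullet> x + b)) / n" for a b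
    using inner_affine_combination[OF l1, of a "\<lambda>x. x" b] by (simp add: q_def sum_divide_distrib)
  \<comment> \<open>A functional that vanishes on the corners of \<open>S\<close> in
    \<open>A\<close> and is 1 at the others; it is positive at \<open>q\<close> because some corner
    lies outside \<open>A\<close>.\<close>
  have indicator: "\<exists>a b. (\<forall>x\<in>S. a \<bullet> x + b = (if x \<in> A then 0 else 1)) \<and> a \<bullet> q + b > 0"
    if A: "\<not> S \<subseteq> A" for A
  proof -
    obtain a b where ab: "\<And>x. x \<in> S \<Longrightarrow> a \<bullet> x + b = (if x \<in> A then 0 else 1)"
      using affine_functional_exists[OF indep(1)[OF S(1)], of "\<lambda>x. if x \<in> A then 0 else 1"] by blast
    obtain y where "y \<in> S" "y \<notin> A" using A by blast
    then have "0 < (\<Sum>x\<in>S. (a \<bullet> x + b))"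
      using Sfin ab by (intro sum_pos2[of S y]) auto
    then show ?thesis using ab n q_val[of a b] by (intro exI[of _ a] exI[of _ b]) auto
  qed
  have q_notin: "q \<notin> convex hull A" if A: "A \<subset> S" for A
  proof
    assume q: "q \<in> convex hull A"
    obtain a b where ab: "\<forall>x\<in>S. a \<bullet> x + b = (if x \<in> A then 0 else 1)" "a \<bullet> q + b > 0"
      using indicator[of A] A by blast
    have "0 \<le> (- a) \<bullet> q + (- b)"
    proof (rule affine_functional_nonneg_convex_hull[OF _ q])
      fix x assume "x \<in> A"
      then have "a \<bullet> x + b = 0" using ab(1) A by auto
      then show "0 \<le> (- a) \<bullet> x + (- b)" by simp
    qed
    then show False using ab(2) by simp
  qed
  have qS: "q \<in> convex hull S"
    unfolding q_def using Sfin l1 n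
    by (intro convex_sum) (auto simp: convex_convex_hull hull_inc)
  have inter: "convex hull A \<inter> convex hull B \<subseteq> convex hull (A \<inter> B)" if "A \<in> \<S>" "B \<in> \<S>" for A B
    using tri that by (auto simp: triangulating_def)
  have proper: "S \<inter> B \<subset> S" if "B \<in> \<S>" "B \<noteq> S" for B
    using that card_subset_eq[OF fin[OF that(1)], of S] indep(2) S(1) by auto
  have q_new: "q \<notin> \<Union>\<S>"
  proof
    assume "q \<in> \<Union>\<S>"
    then obtain B where B: "B \<in> \<S>" "q \<in> B" by blast
    show False
    proof (cases "B = S")
      case True
      then have "{q} \<subset> S" using B cardS by auto
      then show False using q_notin[of "{q}"] by simp
    next
      case False
      then show False
        using q_notin[OF proper] inter[OF S(1) B(1)] qS B hull_inc[of q B convex] by blast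
    qed
  qed
  have q_notin_S: "q \<notin> S" using q_new S(1) by blast
  define new where "new s = insert q (S - {s})" for s
  define \<S>' where "\<S>' = (\<S> - {S}) \<union> new ` S"
  have new_sub: "convex hull (new s) \<subseteq> convex hull S" for s
    unfolding new_def using qS by (intro hull_minimal) (auto intro: hull_inc)
  have new_fin: "finite (new s)" for s using Sfin by (simp add: new_def)
  have new_cover: "convex hull S = (\<Union>s\<in>S. convex hull (new s))"
  proof
    show "convex hull S \<subseteq> (\<Union>s\<in>S. convex hull (new s))"
      using convex_hull_exchange_cover[OF Sfin l1 q_def[symmetric] q_notin_S]
      by (auto simp: new_def)
  qed (use new_sub in blast)
  \<comment> \<open>An old cell meets \<open>S\<close> only in the face spanned by
    \<open>S \<inter> B\<close>. The indicator of this face is nonnegative on the new cell and zero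
    on the face.\<close>
  have new_old: "convex hull (new s) \<inter> convex hull B \<subseteq> convex hull (new s \<inter> B)"
    if B: "B \<in> \<S>" "B \<noteq> S" for s B
  proof
    fix z assume z: "z \<in> convex hull (new s) \<inter> convex hull B"
    then have z': "z \<in> convex hull (S \<inter> B)"
      using new_sub inter[OF S(1) B(1)] by blast
    obtain a b where ab: "\<forall>x\<in>S. a \<bullet> x + b = (if x \<in> S \<inter> B then 0 else 1)" "a \<bullet> q + b > 0"
      using indicator[of "S \<inter> B"] proper[OF B] by blast
    have "convex hull (new s) \<inter> convex hull (S \<inter> B) \<subseteq> convex hull (new s \<inter> (S \<inter> B))"
      using ab by (intro convex_hull_Int_separated[OF new_fin, of _ a b]) (auto simp: new_def split: if_splits)
    then show "z \<in> convex hull (new s \<inter> B)"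
      using z z' hull_mono[of "new s \<inter> (S \<inter> B)" "new s \<inter> B" convex] by blast
  qed
  have new_new: "convex hull (new s) \<inter> convex hull (new t) \<subseteq> convex hull (new s \<inter> new t)"
    if st: "s \<in> S" "t \<in> S" for s t
  proof (cases "s = t")
    case False
    \<comment> \<open>With value 1 at \<open>t\<close>, -1 at \<open>s\<close> and 0 at the other
      corners, the functional is nonnegative on \<open>new s\<close>, which lacks \<open>s\<close>,
      and nonpositive on \<open>new t\<close>, which lacks \<open>t\<close>.\<close>
    obtain a b where ab: "\<And>x. x \<in> S \<Longrightarrow> a \<bullet> x + b = (if x = t then 1 else if x = s then - 1 else 0)"
      using affine_functional_exists[OF indep(1)[OF S(1)],
        of "\<lambda>x. if x = t then 1 else if x = s then - 1 else 0"] by blast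
    have "(\<Sum>x\<in>S. a \<bullet> x + b) = (\<Sum>x\<in>S. (if x = t then 1 else 0) - (if x = s then 1 else 0))"
      using False by (intro sum.cong) (auto simp: ab)
    then have "a \<bullet> q + b = 0"
      using st Sfin by (simp add: q_val sum_subtractf)
    then show ?thesis
      using ab st False
      by (intro convex_hull_Int_separated[OF new_fin, of _ a b]) (auto simp: new_def split: if_splits)
  qed simp
  have tri': "triangulating V \<S>'"
    unfolding triangulating_def
  proof (intro conjI ballI)
    show "finite \<S>'" using tri Sfin by (auto simp: \<S>'_def triangulating_def)
    show "\<not> affine_dependent A" if "A \<in> \<S>'" for A
    proof (cases "A \<in> \<S>")
      case False
      then obtain s where "s \<in> S" "A = new s" using \<open>A \<in> \<S>'\<close> by (auto simp: \<S>'_def)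
      then show ?thesis
        using affine_independent_exchange[OF indep(1)[OF S(1)] l1 q_def[symmetric]] n
        by (simp add: new_def)
    qed (rule indep)
    show "card A = card V" if "A \<in> \<S>'" for A
      using that Sfin q_notin_S indep(2) S(1) cardS
      by (auto simp: \<S>'_def new_def card_Diff_singleton)
    show "convex hull A \<inter> convex hull B \<subseteq> convex hull (A \<inter> B)" if AB: "A \<in> \<S>'" "B \<in> \<S>'" for A B
    proof -
      consider "A \<in> \<S>" "B \<in> \<S>" | s where "s \<in> S" "A = new s" "B \<in> \<S>" "B \<noteq> S"
        | s where "s \<in> S" "B = new s" "A \<in> \<S>" "A \<noteq> S"
        | s t where "s \<in> S" "t \<in> S" "A = new s" "B = new t"
        using AB unfolding \<S>'_def by blast
      then show ?thesis
      proof cases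
        case 3
        then show ?thesis using new_old[of A s] by (simp add: Int_commute)
      qed (simp_all add: inter new_new new_old)
    qed
    have "(\<Union>A\<in>\<S>'. convex hull A) = (\<Union>A\<in>\<S> - {S}. convex hull A) \<union> convex hull S"
      by (auto simp: \<S>'_def new_cover)
    also have "\<dots> = convex hull V"
      using tri S(1) by (auto simp: triangulating_def)
    finally show "(\<Union>A\<in>\<S>'. convex hull A) = convex hull V" .
  qed
  have new_Un: "\<Union>(new ` S) = insert q S"
  proof
    show "insert q S \<subseteq> \<Union>(new ` S)"
    proof
      fix x assume x: "x \<in> insert q S"
      \<comment> \<open>A corner \<open>x\<close> survives in the new cell that drops another corner
        \<open>y\<close>; this is where two corners are required.\<close>
      have "\<not> S \<subseteq> {x}" using cardS card_mono[of "{x}" S] by auto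
      then obtain y where "y \<in> S" "y \<noteq> x" by blast
      then show "x \<in> \<Union>(new ` S)" using x by (auto simp: new_def)
    qed
  qed (auto simp: new_def)
  have Un: "\<Union>\<S>' = insert q (\<Union>\<S>)"
    using new_Un S(1) unfolding \<S>'_def by blast
  have R: "R \<in> \<S>" using red by (simp add: redundant_def)
  have new_R: "new s \<noteq> R" for s using q_new R by (auto simp: new_def)
  have "redundant V \<S>' R"
    unfolding redundant_def
  proof (intro conjI allI impI)
    show "R \<in> \<S>'" using R S by (auto simp: \<S>'_def)
    fix L assume l: "sperner_labelling V (\<Union>\<S>') L"
    then have "sperner_labelling V (\<Union>\<S>) L" by (auto simp: sperner_labelling_def Un)
    then obtain B where B: "B \<in> \<S>" "B \<noteq> R" "L ` B = V"
      using red unfolding redundant_def by blast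
    show "\<exists>A\<in>\<S>'. A \<noteq> R \<and> L ` A = V"
    proof (cases "B = S")
      case True
      have "L q \<in> V" using l by (auto simp: sperner_labelling_def Un)
      then have "L q \<in> L ` S" using B(3) True by simp
      \<comment> \<open>Replacing the corner that shares the label of \<open>q\<close> by
        \<open>q\<close> itself keeps the cell rainbow.\<close>
      then obtain s where s: "s \<in> S" "L q = L s" by blast
      then have "L ` new s = V" using B(3) True by (auto simp: new_def)
      moreover have "new s \<in> \<S>'" using s(1) by (simp add: \<S>'_def)
      ultimately show ?thesis using new_R by blast
    qed (use B in \<open>auto simp: \<S>'_def\<close>)
  qed
  moreover have "\<exists>A\<in>\<S>'. A \<noteq> R"
  proof -
    obtain s where "s \<in> S" using cardS by fastforce
    then have "new s \<in> \<S>'" by (simp add: \<S>'_def)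
    then show ?thesis using new_R by blast
  qed
  moreover have "card (\<Union>\<S>') = Suc (card (\<Union>\<S>))"
    using Un q_new fin tri by (auto simp: triangulating_def)
  ultimately show ?thesis using that tri' by blast
qed

subsection \<open>A triangulation of the tetrahedron\<close>

text \<open>Barycentric coordinates, scaled by 11, of the corners 0 to 3 and the interior points 4 to 7.
  The example was found by a computer search; it is invariant under the half-turn exchanging
  0 with 2, 1 with 3, 4 with 5 and 6 with 7.\<close>

definition coord :: "int list list" where
  "coord = [[11, 0, 0, 0], [0, 11, 0, 0], [0, 0, 11, 0], [0, 0, 0, 11],
            [2, 5, 1, 3], [1, 3, 2, 5], [3, 6, 1, 1], [1, 1, 3, 6]]"

text \<open>Each list is increasing, so that a cell is represented by one list only. The last one is
  the cell spanned by the interior points.\<close>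

definition cell_list :: "nat list list" where
  "cell_list =
     [[0, 1, 2, 6], [0, 1, 3, 6], [0, 2, 3, 7], [0, 2, 6, 7], [0, 3, 4, 5], [0, 3, 4, 6],
      [0, 3, 5, 7], [0, 4, 5, 7], [0, 4, 6, 7], [1, 2, 3, 7], [1, 2, 4, 5], [1, 2, 4, 6],
      [1, 2, 5, 7], [1, 3, 4, 5], [1, 3, 4, 6], [1, 3, 5, 7], [2, 4, 5, 6], [2, 5, 6, 7],
      [4, 5, 6, 7]]"

text \<open>The list \<open>xs\<close> holds the labels of the points 4 to 7. The corners are preset
  to themselves, since a Sperner labelling fixes them; interior points may receive any
  label.\<close>

definition core_labelling_ok :: "nat list \<Rightarrow> bool" where
  "core_labelling_ok xs \<longleftrightarrow>
     list_ex (\<lambda>C. C \<noteq> [4, 5, 6, 7] \<and>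
       list_all (\<lambda>j. j \<in> set (map (\<lambda>k. ([0, 1, 2, 3] @ xs) ! k) C)) [0, 1, 2, 3]) cell_list"

lemma core_labellings: "list_all core_labelling_ok (List.n_lists 4 [0, 1, 2, 3])"
  by code_simp

section \<open>Separation of the 19 cells by planes\<close>

text \<open>Each row is a linear form in the four barycentric coordinates. As these have a constant
  sum, homogeneous forms express all affine functionals.\<close>

definition planes :: "int list list" where
  "planes =
     [[2, 0, -7, 1], [7, -1, -2, 0], [-7, 4, 15, -7], [0, 0, 1, -1], [1, -1, 0, 0],
      [-35, 17, 0, 3], [0, 1, -6, 0], [3, 0, 0, -2], [7, -3, 1, 0], [-2, 0, 1, 0],
      [-15, 7, 7, -4], [6, 0, 0, -1], [0, 3, -1, 0], [-1, 1, -3, 0], [0, 1, 16, -7],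
      [-3, 0, -1, 1], [0, -1, 0, 6], [0, 3, 13, -7], [-16, 7, 0, -1], [-1, 0, 3, 0],
      [0, 1, -5, 0], [0, -3, 35, -17], [-3, 0, 1, 0], [5, 0, 0, -1], [13, -7, 0, 3],
      [24, -9, -31, 13], [1, 0, -2, 0], [1, 0, 0, -3], [1, 0, -3, 1], [0, 2, -3, 0],
      [0, 6, 0, -1], [1, 0, 7, -3], [0, 2, -13, 1], [-13, 1, 0, 2], [27, -14, 0, 3],
      [0, 3, 27, -14], [31, -13, -24, 9]]"

definition val :: "int list \<Rightarrow> nat \<Rightarrow> int" where
  "val w k = w ! 0 * coord ! k ! 0 + w ! 1 * coord ! k ! 1 + w ! 2 * coord ! k ! 2 + w ! 3 * coord ! k ! 3"

text \<open>The disjunction reflects that \<open>convex_hull_Int_separated\<close> asks for shared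
  zeros from one side only, and either cell may take that side.\<close>

definition separates :: "int list \<Rightarrow> nat list \<Rightarrow> nat list \<Rightarrow> bool" where
  "separates w C E \<longleftrightarrow>
     list_all (\<lambda>k. 0 \<le> val w k) C \<and> list_all (\<lambda>k. val w k \<le> 0) E \<and>
     (list_all (\<lambda>k. val w k = 0 \<longrightarrow> k \<in> set E) C \<or>
      list_all (\<lambda>k. val w k = 0 \<longrightarrow> k \<in> set C) E)"

text \<open>Row \<open>i\<close> gives, for each later cell in the list, a plane that separates it from cell \<open>i\<close>.\<close>

definition plane_index :: "nat list list" where
  "plane_index =
     [[3, 16, 16, 3, 3, 3, 3, 3, 7, 7, 27, 7, 3, 3, 3, 16, 16, 3],
      [6, 6, 6, 6, 6, 6, 6, 9, 19, 0, 0, 19, 19, 9, 6, 0, 6],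
      [30, 12, 12, 12, 12, 12, 4, 4, 4, 4, 4, 4, 4, 4, 4, 4],
      [14, 21, 17, 21, 21, 5, 5, 5, 5, 5, 5, 5, 5, 5, 5],
      [20, 29, 14, 14, 22, 2, 2, 14, 8, 13, 1, 2, 14, 2],
      [20, 20, 32, 1, 18, 0, 28, 8, 13, 1, 0, 0, 0],
      [17, 17, 1, 10, 17, 1, 8, 13, 1, 10, 2, 2],
      [35, 11, 2, 2, 1, 8, 13, 1, 2, 2, 2],
      [1, 18, 10, 1, 8, 13, 1, 10, 25, 36],
      [11, 7, 11, 9, 9, 22, 11, 11, 11],
      [7, 23, 31, 0, 15, 18, 18, 10],
      [7, 7, 0, 7, 24, 24, 10],
      [9, 0, 15, 23, 33, 1],
      [26, 9, 8, 8, 8],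
      [9, 0, 0, 0],
      [15, 15, 1],
      [34, 10],
      [25],
      []]"

fun cells_separated :: "nat list list \<Rightarrow> nat list list \<Rightarrow> bool" where
  "cells_separated (C # Cs) (r # rs) \<longleftrightarrow>
     list_all2 (\<lambda>E i. separates (planes ! i) C E \<or> separates (planes ! i) E C) Cs r \<and>
     cells_separated Cs rs"
| "cells_separated [] _ \<longleftrightarrow> True"
| "cells_separated (C # Cs) [] \<longleftrightarrow> False"

lemma cells_separated_cell_list: "cells_separated cell_list plane_index"
  by code_simp

text \<open>A step \<open>(C, q, n)\<close> replaces the cell \<open>C\<close> by the cells with \<open>q\<close> in place of a corner of \<open>C\<close> that has
  a positive coefficient in the affine combination \<open>n\<close> expressing \<open>q\<close> (with an arbitrary common
  denominator). The new cells cover the old one but may overlap, so the intermediate lists need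
  not be triangulations.\<close>

type_synonym step = "nat list \<times> nat \<times> int list"

definition valid_step :: "nat list \<Rightarrow> nat \<Rightarrow> int list \<Rightarrow> bool" where
  "valid_step C q n \<longleftrightarrow> q < 8 \<and> q \<notin> set C \<and>
     0 < n ! 0 + n ! 1 + n ! 2 + n ! 3 \<and>
     list_all (\<lambda>j. (n ! 0 + n ! 1 + n ! 2 + n ! 3) * coord ! q ! j =
       n ! 0 * coord ! (C ! 0) ! j + n ! 1 * coord ! (C ! 1) ! j +
       n ! 2 * coord ! (C ! 2) ! j + n ! 3 * coord ! (C ! 3) ! j) [0, 1, 2, 3]"

text \<open>An invalid step leaves the list unchanged, so that covering is preserved by any step
  whatever. Sorting keeps the lists comparable with \<open>cell_list\<close>.\<close>

fun refine :: "step \<Rightarrow> nat list list \<Rightarrow> nat list list" where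
  "refine (C, q, n) L =
     (if C \<in> set L \<and> valid_step C q n
      then map (\<lambda>i. sort (C[i := q])) (filter (\<lambda>i. 0 < n ! i) [0, 1, 2, 3]) @ removeAll C L
      else L)"

text \<open>If all coefficients are positive, the cell is split at an interior point; a negative one
  means that the new point lies outside the cell, so that the replacing cells stick out of
  it.\<close>

definition steps :: "step list" where
  "steps =
     [([0, 1, 2, 3], 4, [2, 5, 1, 3]),
      ([0, 1, 2, 4], 6, [7, 13, 2, 11]),
      ([0, 1, 4, 6], 3, [1, 1, 11, -11]),
      ([0, 2, 4, 6], 7, [24, 31, 385, -297]),
      ([0, 1, 3, 4], 6, [1, 1, -2, 11]),
      ([0, 2, 3, 4], 7, [3, 14, 27, 11]),
      ([0, 2, 4, 7], 6, [24, 31, 385, -143]),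
      ([2, 4, 6, 7], 5, [1, 31, -15, 7]),
      ([0, 3, 4, 7], 5, [-1, 1, 11, 11]),
      ([2, 3, 4, 7], 5, [7, 15, 22, -11]),
      ([1, 2, 3, 4], 5, [1, 3, 7, 11]),
      ([1, 2, 3, 5], 7, [-2, 1, 1, 11]),
      ([2, 3, 4, 5], 7, [7, 15, 22, -33]),
      ([2, 3, 5, 7], 1, [1, 1, 11, -11]),
      ([2, 4, 5, 7], 6, [1, 31, -24, 7]),
      ([3, 4, 5, 7], 0, [1, 11, -22, 11])]"

lemma fold_refine_steps: "set (fold refine steps [[0, 1, 2, 3]]) = set cell_list"
  by code_simp

lemma cells_separatedD:
  assumes "cells_separated L R" "C \<in> set L" "E \<in> set L" "C \<noteq> E"
  shows "\<exists>w. separates w C E \<or> separates w E C"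
  using assms
proof (induction L R rule: cells_separated.induct)
  case (1 D Ds r rs)
  have head: "\<exists>w. separates w D F \<or> separates w F D" if "F \<in> set Ds" for F
  proof -
    obtain m where m: "m < length Ds" "F = Ds ! m"
      using \<open>F \<in> set Ds\<close> by (auto simp: in_set_conv_nth)
    have "list_all2 (\<lambda>E i. separates (planes ! i) D E \<or> separates (planes ! i) E D) Ds r"
      using 1(2) by simp
    then show ?thesis
      using list_all2_nthD[of _ Ds r m] m by blast
  qed
  show ?case
  proof (cases "C = D \<or> E = D")
    case True
    then show ?thesis using head[of C] head[of E] 1(3-5) by auto
  next
    case False
    then show ?thesis using 1 by simp
  qed
qed auto

subsection \<open>Realization in a simplex\<close>

definition point :: "(nat \<Rightarrow> 'a::euclidean_space) \<Rightarrow> nat \<Rightarrow> 'a" where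
  "point a k = (\<Sum>j<4. (real_of_int (coord ! k ! j) / 11) *\<^sub>R a j)"

lemma sum_lessThan_4: "sum g {..<4::nat} = g 0 + g 1 + g 2 + g 3"
  for g :: "nat \<Rightarrow> 'b::comm_monoid_add"
  by (simp add: eval_nat_numeral)

lemma list_all_upt_8: "list_all P [0..<8] \<Longrightarrow> k < 8 \<Longrightarrow> P k"
  by (simp add: list_all_iff)

lemma coord_row_sum: "k < 8 \<Longrightarrow> (\<Sum>j<4. real_of_int (coord ! k ! j) / 11) = 1"
proof -
  assume k: "k < 8"
  have "list_all (\<lambda>k. coord ! k ! 0 + coord ! k ! 1 + coord ! k ! 2 + coord ! k ! 3 = 11) [0..<8]"
    by code_simp
  from list_all_upt_8[OF this k] have "real_of_int (coord ! k ! 0 + coord ! k ! 1 + coord ! k ! 2 + coord ! k ! 3) = 11"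
    by simp
  then show ?thesis
    by (simp add: sum_lessThan_4)
qed

lemma coord_nonneg: "k < 8 \<Longrightarrow> j < 4 \<Longrightarrow> 0 \<le> coord ! k ! j"
proof -
  assume kj: "k < 8" "j < 4"
  have "list_all (\<lambda>k. list_all (\<lambda>j. 0 \<le> coord ! k ! j) [0..<4]) [0..<8]"
    by code_simp
  from list_all_upt_8[OF this kj(1)] show ?thesis using kj(2) by (simp add: list_all_iff)
qed

lemma point_corner: "k < 4 \<Longrightarrow> point a k = a k"
proof -
  assume "k < 4"
  then consider "k = 0" | "k = 1" | "k = 2" | "k = 3" by linarith
  then show ?thesis by cases (simp_all add: point_def sum_lessThan_4 coord_def)
qed

lemma point_in_convex_hull:
  assumes "k < 8"
  shows "point a k \<in> convex hull (a ` {..<4})"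
  unfolding point_def using assms coord_row_sum coord_nonneg
  by (intro convex_sum) (auto simp: convex_convex_hull hull_inc)

text \<open>\<open>W\<close> consists of the corners of the simplex that do not belong to the tetrahedron.\<close>

locale corners =
  fixes a :: "nat \<Rightarrow> 'a::euclidean_space" and W :: "'a set"
  assumes indep: "\<not> affine_dependent (a ` {..<4} \<union> W)"
    and inj: "inj_on a {..<4}" and disj: "a ` {..<4} \<inter> W = {}"
begin

definition cell :: "nat set \<Rightarrow> 'a set" where
  "cell C = point a ` C \<union> W"

lemma finite_W: "finite W"
  using aff_independent_finite[OF indep] by simp

lemma functional_exists:
  obtains f b where "\<And>k. k < 8 \<Longrightarrow> f \<bullet> point a k + b = val w k / 11" "\<And>x. x \<in> W \<Longrightarrow> f \<bullet> x + b = 0"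
proof -
  define c where "c x = (if x \<in> W then 0 else real_of_int (w ! inv_into {..<4} a x))" for x
  obtain f b where fb: "\<And>x. x \<in> a ` {..<4} \<union> W \<Longrightarrow> f \<bullet> x + b = c x"
    using affine_functional_exists[OF indep, of c] by blast
  have fa: "f \<bullet> a j + b = w ! j" if "j < 4" for j
    using fb[of "a j"] that disj inj by (auto simp: c_def)
  have "f \<bullet> point a k + b = val w k / 11" if "k < 8" for k
  proof -
    have "f \<bullet> point a k + b = (\<Sum>j<4. real_of_int (coord ! k ! j) / 11 * (f \<bullet> a j + b))"
      unfolding point_def by (rule inner_affine_combination[OF coord_row_sum[OF that]])
    also have "\<dots> = (\<Sum>j<4. real_of_int (coord ! k ! j) / 11 * w ! j)"
      using fa by (intro sum.cong) auto
    also have "\<dots> = val w k / 11"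
      by (simp add: sum_lessThan_4 val_def field_simps)
    finally show ?thesis .
  qed
  moreover have "f \<bullet> x + b = 0" if "x \<in> W" for x
    using fb[of x] that by (simp add: c_def)
  ultimately show ?thesis by (rule that)
qed

lemma point_inj: "inj_on (point a) {..<8}"
proof (rule inj_onI)
  fix k l assume kl: "k \<in> {..<8}" "l \<in> {..<8}" "point a k = point a l"
  \<comment> \<open>The first three scaled coordinates, at most 11 each, are read as digits in base
    12; a collision of points would be a collision of these numbers.\<close>
  obtain f b where fb: "\<And>k. k < 8 \<Longrightarrow> f \<bullet> point a k + b = val [1, 12, 144, 0] k / 11"
      "\<And>x. x \<in> W \<Longrightarrow> f \<bullet> x + b = 0"
    using functional_exists[of "[1, 12, 144, 0]"] by blast
  have *: "list_all (\<lambda>k. list_all (\<lambda>l. val [1, 12, 144, 0] k = val [1, 12, 144, 0] l \<longrightarrow> k = l) [0..<8]) [0..<8]"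
    by code_simp
  have "val [1, 12, 144, 0] k = val [1, 12, 144, 0] l"
    using kl fb(1)[of k] fb(1)[of l] by simp
  then show "k = l"
    using list_all_upt_8[OF list_all_upt_8[OF *, of k], of l] kl by simp
qed

lemma point_notin_W:
  assumes "k < 8"
  shows "point a k \<notin> W"
proof
  assume "point a k \<in> W"
  \<comment> \<open>The coordinate sum is 1 at every point but 0 on \<open>W\<close>.\<close>
  obtain f b where fb: "\<And>k. k < 8 \<Longrightarrow> f \<bullet> point a k + b = val [1, 1, 1, 1] k / 11"
    "\<And>x. x \<in> W \<Longrightarrow> f \<bullet> x + b = 0"
    using functional_exists[of "[1, 1, 1, 1]"] by blast
  have *: "list_all (\<lambda>k. val [1, 1, 1, 1] k = 11) [0..<8]"
    by code_simp
  show False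
    using list_all_upt_8[OF *, of k] fb(1)[of k] fb(2)[of "point a k"] assms \<open>point a k \<in> W\<close> by simp
qed

lemma cell_exchange:
  assumes "C \<subseteq> {..<8}" "k \<in> C"
  shows "cell (insert q (C - {k})) = insert (point a q) (cell C - {point a k})"
proof -
  have "point a ` (C - {k}) = point a ` C - {point a k}"
    using assms inj_on_image_set_diff[OF point_inj, of C "{k}"] by auto
  moreover have "point a k \<notin> W" using assms point_notin_W by auto
  ultimately show ?thesis by (auto simp: cell_def)
qed

lemma card_cell:
  assumes "C \<subseteq> {..<8}"
  shows "card (cell C) = card C + card W"
proof -
  have "card (point a ` C) = card C"
    using inj_on_subset[OF point_inj assms] by (rule card_image)
  moreover have "point a ` C \<inter> W = {}" using point_notin_W assms by auto
  ultimately show ?thesis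
    using finite_W finite_subset[OF assms] by (simp add: cell_def card_Un_disjoint)
qed

text \<open>Dividing the integers \<open>n\<close> by their positive sum \<open>D\<close> gives the
  affine coefficients; the elements of \<open>W\<close> get weight zero, so they are never
  exchanged.\<close>

lemma valid_step_combination:
  assumes C: "length C = 4" "distinct C" "set C \<subseteq> {..<8}" and step: "valid_step C q n"
  obtains l where "sum l (cell (set C)) = 1" "(\<Sum>x\<in>cell (set C). l x *\<^sub>R x) = point a q"
    "\<And>x. x \<in> W \<Longrightarrow> l x = 0" "\<And>i. i < 4 \<Longrightarrow> 0 < l (point a (C ! i)) \<longleftrightarrow> 0 < n ! i"
proof -
  define D where "D = n ! 0 + n ! 1 + n ! 2 + n ! 3"
  have D: "0 < D" using step by (simp add: valid_step_def D_def)
  define p where "p i = point a (C ! i)" for i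
  have Ci: "C ! i < 8" if "i < 4" for i
  proof -
    have "C ! i \<in> set C" using that C(1) by simp
    then show ?thesis using C(3) by blast
  qed
  have p_inj: "inj_on p {..<4}"
  proof (rule inj_onI)
    fix i j assume ij: "i \<in> {..<4}" "j \<in> {..<4}" "p i = p j"
    then have "C ! i = C ! j"
      using Ci inj_onD[OF point_inj, of "C ! i" "C ! j"] by (simp add: p_def)
    then show "i = j" using ij C nth_eq_iff_index_eq[of C i j] by simp
  qed
  have "set C = (!) C ` {..<4}"
    using C(1) by (auto simp: set_conv_nth)
  then have cell_p: "cell (set C) = p ` {..<4} \<union> W"
    by (simp add: cell_def p_def image_image)
  have disj_p: "p ` {..<4} \<inter> W = {}"
    using Ci point_notin_W by (auto simp: p_def)
  define l where "l x = (if x \<in> W then 0 else real_of_int (n ! inv_into {..<4} p x) / D)" for x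
  have lW: "l x = 0" if "x \<in> W" for x using that by (simp add: l_def)
  have lp: "l (p i) = real_of_int (n ! i) / D" if "i < 4" for i
    using that disj_p inv_into_f_f[OF p_inj, of i] by (auto simp: l_def)
  have sum_cell: "sum g (cell (set C)) = (\<Sum>i<4. g (p i))" if "\<And>x. x \<in> W \<Longrightarrow> g x = 0"
    for g :: "'a \<Rightarrow> 'b::comm_monoid_add"
    using that finite_W disj_p sum.reindex[OF p_inj, of g]
    by (simp add: cell_p sum.union_disjoint)
  have "sum l (cell (set C)) = (\<Sum>i<4. real_of_int (n ! i) / D)"
    using sum_cell[OF lW] lp by simp
  also have "\<dots> = (\<Sum>i<4. real_of_int (n ! i)) / D"
    by (rule sum_divide_distrib[symmetric])
  also have "(\<Sum>i<4. real_of_int (n ! i)) = D"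
    by (simp add: D_def sum_lessThan_4)
  finally have 1: "sum l (cell (set C)) = 1" using D by simp
  have coords: "(\<Sum>i<4. real_of_int (n ! i) / D * (real_of_int (coord ! (C ! i) ! j) / 11))
      = real_of_int (coord ! q ! j) / 11" if "j < 4" for j
  proof -
    have j: "j = 0 \<or> j = 1 \<or> j = 2 \<or> j = 3" using that by linarith
    have "D * coord ! q ! j = n ! 0 * coord ! (C ! 0) ! j + n ! 1 * coord ! (C ! 1) ! j +
       n ! 2 * coord ! (C ! 2) ! j + n ! 3 * coord ! (C ! 3) ! j"
      using step j unfolding valid_step_def D_def by auto
    then have "real_of_int (D * coord ! q ! j) = real_of_int (n ! 0 * coord ! (C ! 0) ! j +
        n ! 1 * coord ! (C ! 1) ! j + n ! 2 * coord ! (C ! 2) ! j + n ! 3 * coord ! (C ! 3) ! j)"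
      by simp
    then have "real_of_int (coord ! q ! j) = real_of_int (n ! 0 * coord ! (C ! 0) ! j +
        n ! 1 * coord ! (C ! 1) ! j + n ! 2 * coord ! (C ! 2) ! j + n ! 3 * coord ! (C ! 3) ! j) / D"
      using D by (simp add: field_simps)
    then show ?thesis by (simp add: sum_lessThan_4 add_divide_distrib)
  qed
  have "(\<Sum>x\<in>cell (set C). l x *\<^sub>R x) = (\<Sum>i<4. (real_of_int (n ! i) / D) *\<^sub>R p i)"
    using sum_cell[of "\<lambda>x. l x *\<^sub>R x"] lW lp by simp
  also have "\<dots> = (\<Sum>i<4. \<Sum>j<4. (real_of_int (n ! i) / D * (real_of_int (coord ! (C ! i) ! j) / 11)) *\<^sub>R a j)"
    by (simp add: p_def point_def scaleR_sum_right)
  \<comment> \<open>Collecting the coefficient of each \<open>a j\<close> reduces the identity to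
    the integer equations checked by \<open>valid_step\<close>.\<close>
  also have "\<dots> = (\<Sum>j<4. (\<Sum>i<4. real_of_int (n ! i) / D * (real_of_int (coord ! (C ! i) ! j) / 11)) *\<^sub>R a j)"
    by (subst sum.swap) (simp add: scaleR_sum_left)
  also have "\<dots> = point a q"
    unfolding point_def by (intro sum.cong refl) (simp only: coords lessThan_iff)
  finally have 2: "(\<Sum>x\<in>cell (set C). l x *\<^sub>R x) = point a q" .
  have 3: "0 < l (point a (C ! i)) \<longleftrightarrow> 0 < n ! i" if "i < 4" for i
    using lp[OF that] D by (simp add: p_def zero_less_divide_iff)
  show ?thesis by (rule that[OF 1 2 lW 3])
qed

text \<open>The invariant of the steps: independent cells that cover the simplex and may overlap.
  Proper intersections are established only for the final list, by the planes.\<close>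

definition refinement :: "nat list list \<Rightarrow> bool" where
  "refinement L \<longleftrightarrow>
     (\<forall>C\<in>set L. length C = 4 \<and> distinct C \<and> set C \<subseteq> {..<8} \<and> \<not> affine_dependent (cell (set C))) \<and>
     convex hull (cell {0, 1, 2, 3}) \<subseteq> (\<Union>C\<in>set L. convex hull (cell (set C)))"

lemma refinement_refine:
  assumes L: "refinement L"
  shows "refinement (refine (C, q, n) L)"
proof (cases "C \<in> set L \<and> valid_step C q n")
  case True
  then have CL: "C \<in> set L" and step: "valid_step C q n" by auto
  have C: "length C = 4" "distinct C" "set C \<subseteq> {..<8}" "\<not> affine_dependent (cell (set C))"
    using CL L by (auto simp: refinement_def)
  have q: "q < 8" "q \<notin> set C" using step by (auto simp: valid_step_def)
  obtain l where l: "sum l (cell (set C)) = 1" "(\<Sum>x\<in>cell (set C). l x *\<^sub>R x) = point a q"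
    "\<And>x. x \<in> W \<Longrightarrow> l x = 0" "\<And>i. i < 4 \<Longrightarrow> 0 < l (point a (C ! i)) \<longleftrightarrow> 0 < n ! i"
    using valid_step_combination[OF C(1-3) step] by blast
  define new where "new i = sort (C[i := q])" for i
  have set_new: "set (new i) = insert q (set C - {C ! i})" if "i < 4" for i
    using that C by (simp add: new_def set_update_distinct)
  have cell_new: "cell (set (new i)) = insert (point a q) (cell (set C) - {point a (C ! i)})"
    if "i < 4" for i
    using that C by (simp add: set_new cell_exchange)
  define I where "I = {i\<in>{0, 1, 2, 3}. 0 < n ! i}"
  have I4: "i < 4" if "i \<in> I" for i using that by (auto simp: I_def)
  have refine: "set (refine (C, q, n) L) = new ` I \<union> (set L - {C})"
    using True by (auto simp: new_def I_def)
  have q_notin: "point a q \<notin> cell (set C)"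
    using q C(3) point_notin_W inj_on_image_mem_iff[OF point_inj, of q "set C"] by (auto simp: cell_def)
  have fin: "finite (cell (set C))" by (simp add: cell_def finite_W)
  have cover: "convex hull (cell (set C)) \<subseteq> (\<Union>i\<in>I. convex hull (cell (set (new i))))"
  proof
    fix z assume "z \<in> convex hull (cell (set C))"
    then obtain s where s: "s \<in> cell (set C)" "0 < l s"
        "z \<in> convex hull (insert (point a q) (cell (set C) - {s}))"
      using convex_hull_exchange_cover[OF fin l(1,2) q_notin] by blast
    then have "s \<in> point a ` set C" using l(3) by (auto simp: cell_def)
    then obtain i where i: "i < 4" "s = point a (C ! i)"
      using C(1) by (auto simp: in_set_conv_nth)
    then have "0 < n ! i" using s(2) l(4)[OF i(1)] by simp
    then have "i \<in> I" using i(1) by (auto simp: I_def)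
    moreover have "z \<in> convex hull (cell (set (new i)))"
      using s(3) unfolding cell_new[OF i(1)] i(2) .
    ultimately show "z \<in> (\<Union>i\<in>I. convex hull (cell (set (new i))))" by blast
  qed
  have good: "length (new i) = 4 \<and> distinct (new i) \<and> set (new i) \<subseteq> {..<8} \<and>
      \<not> affine_dependent (cell (set (new i)))" if i: "i \<in> I" for i
  proof (intro conjI)
    show "length (new i) = 4" using C by (simp add: new_def)
    show "distinct (new i)" using C q I4[OF i] by (simp add: new_def distinct_list_update)
    show "set (new i) \<subseteq> {..<8}" using C(3) q set_new[OF I4[OF i]] by auto
    have "C ! i \<in> set C" using C(1) I4[OF i] by simp
    then have "point a (C ! i) \<in> cell (set C)" by (simp add: cell_def)
    moreover have "l (point a (C ! i)) \<noteq> 0" using l(4)[OF I4[OF i]] i by (auto simp: I_def)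
    ultimately show "\<not> affine_dependent (cell (set (new i)))"
      unfolding cell_new[OF I4[OF i]] by (rule affine_independent_exchange[OF C(4) l(1,2)])
  qed
  have "convex hull (cell {0, 1, 2, 3}) \<subseteq> (\<Union>C\<in>set L. convex hull (cell (set C)))"
    using L by (simp add: refinement_def)
  also have "\<dots> \<subseteq> (\<Union>C\<in>new ` I \<union> (set L - {C}). convex hull (cell (set C)))"
    using cover by auto
  finally show ?thesis
    unfolding refinement_def refine using L good by (auto simp: refinement_def)
next
  case False
  then have "refine (C, q, n) L = L" by auto
  then show ?thesis using L by simp
qed

lemma cell_corners: "cell {0, 1, 2, 3} = a ` {..<4} \<union> W"
proof -
  have "{..<4} = {0, 1, 2, 3::nat}" by auto
  then show ?thesis by (simp add: cell_def point_corner)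
qed

lemma refinement_cell_list: "refinement cell_list"
proof -
  have "refinement [[0, 1, 2, 3]]"
    using indep cell_corners by (simp add: refinement_def)
  then have "refinement (fold refine ss [[0, 1, 2, 3]])" for ss
    by (rule fold_invariant[where Q = "\<lambda>_. True", rotated]) (auto simp: refinement_refine simp del: refine.simps)
  moreover have "set (fold refine steps [[0, 1, 2, 3]]) = set cell_list"
    by (rule fold_refine_steps)
  \<comment> \<open>The invariant depends only on the set of the list, so order and repetitions do
    not matter.\<close>
  ultimately show ?thesis by (metis (no_types, lifting) refinement_def)
qed

lemma cell_Int_separated:
  assumes CE: "set C \<subseteq> {..<8}" "set E \<subseteq> {..<8}" and sep: "separates w C E"
  shows "convex hull (cell (set C)) \<inter> convex hull (cell (set E)) \<subseteq> convex hull (cell (set C) \<inter> cell (set E))"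
proof -
  obtain f b where fb: "\<And>k. k < 8 \<Longrightarrow> f \<bullet> point a k + b = val w k / 11"
    "\<And>x. x \<in> W \<Longrightarrow> f \<bullet> x + b = 0"
    using functional_exists[of w] by blast
  have sgn: "0 \<le> f \<bullet> point a k + b \<longleftrightarrow> 0 \<le> val w k" "f \<bullet> point a k + b \<le> 0 \<longleftrightarrow> val w k \<le> 0"
    "f \<bullet> point a k + b = 0 \<longleftrightarrow> val w k = 0" if "k < 8" for k
    unfolding fb(1)[OF that] by (simp_all add: divide_le_0_iff)
  have fC: "0 \<le> f \<bullet> x + b" if "x \<in> cell (set C)" for x
    using that CE(1) sgn(1) fb(2) sep by (auto simp: cell_def separates_def list_all_iff subset_iff)
  have fE: "f \<bullet> x + b \<le> 0" if "x \<in> cell (set E)" for x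
    using that CE(2) sgn(2) fb(2) sep by (auto simp: cell_def separates_def list_all_iff subset_iff)
  have fin: "finite (cell (set F))" for F by (simp add: cell_def finite_W)
  consider "\<forall>k\<in>set C. val w k = 0 \<longrightarrow> k \<in> set E" | "\<forall>k\<in>set E. val w k = 0 \<longrightarrow> k \<in> set C"
    using sep by (auto simp: separates_def list_all_iff)
  then show ?thesis
  proof cases
    case 1
    then have "x \<in> cell (set E)" if "x \<in> cell (set C)" "f \<bullet> x + b = 0" for x
      using that CE(1) sgn(3) by (auto simp: cell_def subset_iff)
    then show ?thesis using fin fC fE by (intro convex_hull_Int_separated) auto
  next
    case 2
    \<comment> \<open>Here the zeros are shared from the side of \<open>E\<close>, so the criterion
      is applied to the negated functional with the two cells exchanged.\<close>
    have "x \<in> cell (set C)" if "x \<in> cell (set E)" "(- f) \<bullet> x + (- b) = 0" for x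
    proof -
      have "f \<bullet> x + b = 0" using that(2) by simp
      then show ?thesis using 2 that(1) CE(2) sgn(3) by (auto simp: cell_def subset_iff)
    qed
    moreover have "0 \<le> (- f) \<bullet> x + (- b)" if "x \<in> cell (set E)" for x
      using fE[OF that] by simp
    moreover have "(- f) \<bullet> x + (- b) \<le> 0" if "x \<in> cell (set C)" for x
      using fC[OF that] by simp
    ultimately have "convex hull (cell (set E)) \<inter> convex hull (cell (set C))
        \<subseteq> convex hull (cell (set E) \<inter> cell (set C))"
      by (rule convex_hull_Int_separated[OF fin, rotated 2])
    then show ?thesis by (simp add: Int_commute)
  qed
qed

definition example :: "'a set set" where
  "example = (\<lambda>C. cell (set C)) ` set cell_list"

lemma cell_listD:
  assumes "C \<in> set cell_list"
  shows "length C = 4" "distinct C" "set C \<subseteq> {..<8}" "\<not> affine_dependent (cell (set C))"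
  using assms refinement_cell_list by (auto simp: refinement_def)

lemma cell_subset_convex_hull:
  assumes "C \<subseteq> {..<8}"
  shows "cell C \<subseteq> convex hull (a ` {..<4} \<union> W)"
proof -
  have "convex hull (a ` {..<4}) \<subseteq> convex hull (a ` {..<4} \<union> W)"
    by (simp add: hull_mono)
  then show ?thesis
    using assms point_in_convex_hull[of _ a] hull_inc[of _ "a ` {..<4} \<union> W" convex]
    by (auto simp: cell_def)
qed

lemma triangulating_example: "triangulating (a ` {..<4} \<union> W) example"
  unfolding triangulating_def
proof (intro conjI ballI)
  show "finite example" by (simp add: example_def)
next
  fix S assume "S \<in> example"
  then obtain C where C: "C \<in> set cell_list" "S = cell (set C)" by (auto simp: example_def)
  then show "\<not> affine_dependent S" using cell_listD by simp
  have "card (cell (set C)) = card (cell {0, 1, 2, 3})"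
    using cell_listD[OF C(1)] by (simp add: card_cell distinct_card)
  then show "card S = card (a ` {..<4} \<union> W)" using C cell_corners by simp
next
  fix S S' assume "S \<in> example" "S' \<in> example"
  then obtain C E where CE: "C \<in> set cell_list" "S = cell (set C)" "E \<in> set cell_list" "S' = cell (set E)"
    by (auto simp: example_def)
  show "convex hull S \<inter> convex hull S' \<subseteq> convex hull (S \<inter> S')"
  proof (cases "C = E")
    case False
    then obtain w where "separates w C E \<or> separates w E C"
      using cells_separatedD[OF cells_separated_cell_list CE(1,3)] by blast
    then show ?thesis
      using cell_Int_separated[of C E w] cell_Int_separated[of E C w] cell_listD(3) CE
      by (auto simp: Int_commute)
  qed (use CE in simp)
next
  show "(\<Union>S\<in>example. convex hull S) = convex hull (a ` {..<4} \<union> W)"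
  proof
    have "convex hull (cell (set C)) \<subseteq> convex hull (a ` {..<4} \<union> W)" if "C \<in> set cell_list" for C
      using cell_subset_convex_hull[OF cell_listD(3)[OF that]] by (simp add: hull_minimal)
    then show "(\<Union>S\<in>example. convex hull S) \<subseteq> convex hull (a ` {..<4} \<union> W)"
      by (auto simp: example_def)
    show "convex hull (a ` {..<4} \<union> W) \<subseteq> (\<Union>S\<in>example. convex hull S)"
      using refinement_cell_list unfolding refinement_def example_def cell_corners by simp
  qed
qed

text \<open>Every other cell has a corner of the tetrahedron among its points.\<close>

lemma cell_ne_core:
  assumes "C \<in> set cell_list" "C \<noteq> [4, 5, 6, 7]"
  shows "cell (set C) \<noteq> cell {4, 5, 6, 7}"
proof -
  have "list_all (\<lambda>C. C \<noteq> [4, 5, 6, 7] \<longrightarrow> list_ex (\<lambda>k. k < 4) C) cell_list"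
    by code_simp
  then obtain k where k: "k \<in> set C" "k < 4"
    using assms by (auto simp: list_all_iff list_ex_iff)
  then have "point a k \<in> cell (set C)" by (simp add: cell_def)
  moreover have "point a k \<notin> point a ` {4, 5, 6, 7}"
    using k(2) inj_on_image_mem_iff[OF point_inj, of k "{4, 5, 6, 7}"] by auto
  ultimately show ?thesis using point_notin_W[of k] k(2) by (auto simp: cell_def)
qed

text \<open>Corners carry their own labels, and no point of the tetrahedron can be labelled in
  \<open>W\<close>. What remains is a labelling of the four interior points by four labels, which
  \<open>core_labellings\<close> settles.\<close>

lemma redundant_example: "redundant (a ` {..<4} \<union> W) example (cell {4, 5, 6, 7})"
  unfolding redundant_def
proof (intro conjI allI impI)
  have "[4, 5, 6, 7] \<in> set cell_list" by (simp add: cell_list_def)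
  then show "cell {4, 5, 6, 7} \<in> example" by (force simp: example_def)
  fix L assume L: "sperner_labelling (a ` {..<4} \<union> W) (\<Union>example) L"
  let ?V = "a ` {..<4} \<union> W"
  have verts: "?V \<subseteq> \<Union>example"
    using vertices_subset_Union[OF triangulating_example indep] .
  have L_V: "L v = v" if "v \<in> ?V" for v
  proof (rule ccontr)
    assume "L v \<noteq> v"
    then have "v \<in> convex hull (?V - {L v})" using that by (intro hull_inc) auto
    then show False using L verts that unfolding sperner_labelling_def by blast
  qed
  have "\<forall>k<8. \<exists>j<4. L (point a k) = a j"
  proof (intro allI impI)
    fix k :: nat assume k: "k < 8"
    have "\<forall>k<8. list_ex (\<lambda>C. k \<in> set C) cell_list"
    proof (intro allI impI)
      have "list_all (\<lambda>k. list_ex (\<lambda>C. k \<in> set C) cell_list) [0..<8]" by code_simp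
      then show "list_ex (\<lambda>C. k \<in> set C) cell_list" if "k < 8" for k using that by (simp add: list_all_iff)
    qed
    then obtain C where C: "C \<in> set cell_list" "k \<in> set C" using k by (auto simp: list_ex_iff)
    then have "point a k \<in> \<Union>example" by (auto simp: example_def cell_def)
    then have LP: "L (point a k) \<in> ?V" "point a k \<notin> convex hull (?V - {L (point a k)})"
      using L unfolding sperner_labelling_def by blast+
    have "L (point a k) \<notin> W"
    proof
      assume "L (point a k) \<in> W"
      \<comment> \<open>The tetrahedron lies in the facet opposite any corner from \<open>W\<close>,
        which excludes such a label.\<close>
      then have "a ` {..<4} \<subseteq> ?V - {L (point a k)}" using disj by auto
      then show False using LP(2) point_in_convex_hull[OF k, of a] hull_mono by blast
    qed
    then show "\<exists>j<4. L (point a k) = a j" using LP(1) by auto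
  qed
  then obtain m where m: "\<And>k. k < 8 \<Longrightarrow> m k < 4" "\<And>k. k < 8 \<Longrightarrow> L (point a k) = a (m k)"
    by metis
  have m_id: "m k = k" if "k < 4" for k
    using m[of k] that L_V[of "a k"] point_corner[OF that, of a] inj_onD[OF inj, of "m k" k] by auto
  define xs where "xs = [m 4, m 5, m 6, m 7]"
  have "xs \<in> set (List.n_lists 4 [0, 1, 2, 3])"
    using m(1)[of 4] m(1)[of 5] m(1)[of 6] m(1)[of 7] by (auto simp: set_n_lists xs_def)
  then have "core_labelling_ok xs"
    using core_labellings by (simp add: list_all_iff)
  then obtain C where C: "C \<in> set cell_list" "C \<noteq> [4, 5, 6, 7]"
      "\<forall>j\<in>set [0, 1, 2, 3]. j \<in> set (map (\<lambda>k. ([0, 1, 2, 3] @ xs) ! k) C)"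
    unfolding core_labelling_ok_def list_ex_iff list_all_iff by blast
  have nth_m: "([0, 1, 2, 3] @ xs) ! k = m k" if "k < 8" for k
  proof -
    have "k = 0 \<or> k = 1 \<or> k = 2 \<or> k = 3 \<or> k = 4 \<or> k = 5 \<or> k = 6 \<or> k = 7"
      using that by linarith
    then show ?thesis using m_id[of 0] m_id[of 1] m_id[of 2] m_id[of 3] by (auto simp: xs_def)
  qed
  have C8: "set C \<subseteq> {..<8}" using cell_listD(3)[OF C(1)] .
  have "L ` cell (set C) = ?V"
  proof
    show "L ` cell (set C) \<subseteq> ?V"
      using C8 m L_V by (auto simp: cell_def subset_iff)
    have "a j \<in> L ` cell (set C)" if "j < 4" for j
    proof -
      have "j \<in> set [0, 1, 2, 3]" using that by auto
      then obtain k where "k \<in> set C" "j = ([0, 1, 2, 3] @ xs) ! k"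
        using C(3) by auto
      then have "k \<in> set C" "a j = L (point a k)" using C8 nth_m m(2) by auto
      then show ?thesis by (auto simp: cell_def)
    qed
    moreover have "x \<in> L ` cell (set C)" if "x \<in> W" for x
      using L_V[of x] that by (force simp: cell_def)
    ultimately show "?V \<subseteq> L ` cell (set C)" by auto
  qed
  then show "\<exists>S\<in>example. S \<noteq> cell {4, 5, 6, 7} \<and> L ` S = ?V"
    using cell_ne_core[OF C(1,2)] C(1) by (auto simp: example_def)
qed

end

section \<open>Infinitely many triangulations\<close>

lemma redundant_triangulation_exists:
  fixes V :: "'a::euclidean_space set"
  assumes V: "\<not> affine_dependent V" "4 \<le> card V"
  obtains \<S> R where "triangulating V \<S>" "redundant V \<S> R" "\<exists>S\<in>\<S>. S \<noteq> R"
proof -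
  \<comment> \<open>Any four corners can span the tetrahedron; the remaining ones become
    \<open>W\<close>.\<close>
  obtain A where A: "A \<subseteq> V" "card A = 4" "finite A"
    using obtain_subset_with_card_n[OF V(2)] by blast
  obtain a :: "nat \<Rightarrow> 'a" where a: "bij_betw a {0..<4} A"
    using ex_bij_betw_nat_finite[OF A(3)] A(2) by auto
  have aA: "a ` {..<4} = A" "inj_on a {..<4}"
    using a by (auto simp: bij_betw_def atLeast0LessThan)
  have V_eq: "a ` {..<4} \<union> (V - A) = V" using aA A by auto
  interpret corners a "V - A"
  proof
    show "\<not> affine_dependent (a ` {..<4} \<union> (V - A))" unfolding V_eq by (rule V)
    show "inj_on a {..<4}" by (rule aA)
    show "a ` {..<4} \<inter> (V - A) = {}" using aA(1) by auto
  qed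
  have C: "[0, 1, 2, 6] \<in> set cell_list" by (simp add: cell_list_def)
  have "cell (set [0, 1, 2, 6]) \<in> example"
    unfolding example_def using C by (rule imageI)
  moreover have "cell (set [0, 1, 2, 6]) \<noteq> cell {4, 5, 6, 7}"
    by (rule cell_ne_core[OF C]) simp
  ultimately have "\<exists>S\<in>example. S \<noteq> cell {4, 5, 6, 7}" by (rule bexI[rotated])
  then show ?thesis
    using that[of example] triangulating_example redundant_example unfolding V_eq by simp
qed

text \<open>Iterated subdivision, with the same \<open>R\<close> throughout, realizes every larger
  vertex number.\<close>

lemma redundant_triangulation_card:
  fixes V :: "'a::euclidean_space set"
  assumes "triangulating V \<S>" "redundant V \<S> R" "\<exists>S\<in>\<S>. S \<noteq> R" "2 \<le> card V"
  shows "\<exists>\<S>'. triangulating V \<S>' \<and> redundant V \<S>' R \<and> (\<exists>S\<in>\<S>'. S \<noteq> R) \<and>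
    card (\<Union>\<S>') = card (\<Union>\<S>) + n"
proof (induction n)
  case 0
  then show ?case using assms by auto
next
  case (Suc n)
  then obtain \<S>' S where S': "triangulating V \<S>'" "redundant V \<S>' R" "S \<in> \<S>'" "S \<noteq> R"
    "card (\<Union>\<S>') = card (\<Union>\<S>) + n" by blast
  obtain \<S>'' where "triangulating V \<S>''" "redundant V \<S>'' R" "\<exists>S\<in>\<S>''. S \<noteq> R"
    "card (\<Union>\<S>'') = Suc (card (\<Union>\<S>'))"
    using stellar_subdivision[OF S'(1-4) assms(4)] .
  then show ?case using S'(5) by (intro exI[of _ \<S>'']) simp
qed

theorem theorem3p4:
  fixes d :: nat and T :: "'a::euclidean_space set"
  assumes "3 \<le> d" and "int d simplex T"
  shows "\<exists>\<K>. infinite \<K> \<and>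
           (\<forall>K\<in>\<K>. triangulation_of K T \<and> \<not> critical (d + 2) (triangulation_graph d T K)) \<and>
           pairwise (\<lambda>K L. \<not> simplicially_isomorphic K L) \<K>"
proof -
  obtain V where V: "\<not> affine_dependent V" "card V = Suc d" "T = convex hull V"
    using assms(2) unfolding simplex_def by force
  obtain \<S>0 R where S0: "triangulating V \<S>0" "redundant V \<S>0 R" "\<exists>S\<in>\<S>0. S \<noteq> R"
    using redundant_triangulation_exists[of V] V assms(1) by auto
  have "\<forall>n. \<exists>\<S>. triangulating V \<S> \<and> redundant V \<S> R \<and> card (\<Union>\<S>) = card (\<Union>\<S>0) + n"
    using redundant_triangulation_card[OF S0] V(2) assms(1) by fastforce
  from choice[OF this] obtain \<S> where S: "\<And>n. triangulating V (\<S> n)" "\<And>n. redundant V (\<S> n) R"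
    "\<And>n. card (\<Union>(\<S> n)) = card (\<Union>\<S>0) + n"
    by blast
  define K where "K n = face_complex (\<S> n)" for n
  have card_K: "card (complex_vertices (K n)) = card (\<Union>\<S>0) + n" for n
    using S(3) complex_vertices_face_complex[OF S(1)] by (simp add: K_def)
  have "inj K"
  proof (rule injI)
    fix m n assume "K m = K n"
    then have "card (\<Union>\<S>0) + m = card (\<Union>\<S>0) + n" unfolding card_K[symmetric] by (rule arg_cong)
    then show "m = n" by simp
  qed
  then have "infinite (range K)" using finite_imageD infinite_UNIV_nat by blast
  moreover have "triangulation_of (K n) T \<and> \<not> critical (d + 2) (triangulation_graph d T (K n))" for n
    using triangulation_of_face_complex[OF S(1) V(1)]
      not_critical_if_redundant[OF S(1,2) V(1,2)] assms(1) V(3) by (simp add: K_def)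
  moreover have "pairwise (\<lambda>K L. \<not> simplicially_isomorphic K L) (range K)"
  proof (rule pairwiseI, rule notI)
    fix A B assume AB: "A \<in> range K" "B \<in> range K" "A \<noteq> B" "simplicially_isomorphic A B"
    then obtain m n where mn: "A = K m" "B = K n" by blast
    \<comment> \<open>The number of vertices is invariant under simplicial isomorphism and tells the
      complexes apart.\<close>
    have "card (complex_vertices A) = card (complex_vertices B)"
      using AB(4) bij_betw_same_card unfolding simplicially_isomorphic_def by blast
    then have "m = n" unfolding mn card_K by simp
    then show False using AB(3) mn by simp
  qed
  ultimately show ?thesis by (intro exI[of _ "range K"]) auto
qed

end
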